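(* There exists a polynomial-time algorithm which, for every $s$-thin instance $(P,D)$ of \textsc{MinGMConn}, outputs a feasible solution $Q$ with $|Q|\le O(\log s)\cdot \mathrm{opt}(P,D)$ (the constant hidden in the $O$-notation being absolute); i.e., \textsc{MinGMConn} admits an efficient $O(\log s)$-approximation on $s$-thin instances.
   Context: For a finite set $X\subseteq\mathbb{R}^2$, two points $p,q\in X$ are M-connected in $X$ if there is a sequence $p=x_0,\dots,x_k=q$ of points of $X$ with consecutive points horizontally or vertically aligned and $\sum_{i}\|x_i-x_{i+1}\|_1=\|p-q\|_1$. An instance of \textsc{MinGMConn} is a finite point set $P\subseteq\mathbb{R}^2$ together with demands $D\subseteq P\times P$; here distinct points of $P$ may share an $x$-coordinate but have pairwise distinct $y$-coordinates. A feasible solution is a set $Q\subseteq\mathbb{R}^2$ such that every $(p,q)\in D$ is M-connected in $P\cup Q$, and $\mathrm{opt}(P,D)$ is the minimum size of a feasible solution. The instance is $s$-thin if the points of $P$ lie on at most $s$ distinct $x$-coordinates. *)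

theory Defs
  imports Complex_Main "HOL-Computational_Algebra.Polynomial"
begin

section \<open>Generalized Manhattan connections\<close>

type_synonym point = "real \<times> real"

definition l1_dist :: "point \<Rightarrow> point \<Rightarrow> real" where
  "l1_dist p q = \<bar>fst p - fst q\<bar> + \<bar>snd p - snd q\<bar>"

definition aligned :: "point \<Rightarrow> point \<Rightarrow> bool" where
  "aligned p q \<longleftrightarrow> fst p = fst q \<or> snd p = snd q"

definition M_connected :: "point set \<Rightarrow> point \<Rightarrow> point \<Rightarrow> bool" where
  "M_connected X p q \<longleftrightarrow>
     (\<exists>(x :: nat \<Rightarrow> point) k. x 0 = p \<and> x k = q \<and> (\<forall>i\<le>k. x i \<in> X) \<and>
        (\<forall>i<k. aligned (x i) (x (Suc i))) \<and>
        (\<Sum>i<k. l1_dist (x i) (x (Suc i))) = l1_dist p q)"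

definition gmconn_instance :: "point set \<Rightarrow> (point \<times> point) set \<Rightarrow> bool" where
  "gmconn_instance P D \<longleftrightarrow> finite P \<and> D \<subseteq> P \<times> P \<and> inj_on snd P"

definition feasible :: "point set \<Rightarrow> (point \<times> point) set \<Rightarrow> point set \<Rightarrow> bool" where
  "feasible P D Q \<longleftrightarrow> finite Q \<and> (\<forall>(p, q) \<in> D. M_connected (P \<union> Q) p q)"

text \<open>On every instance a feasible solution exists: for each demand \<open>((a, b), (c, d))\<close>,
  take the corner \<open>(a, d)\<close>. Hence the least number below is attained.\<close>

definition opt :: "point set \<Rightarrow> (point \<times> point) set \<Rightarrow> nat" where
  "opt P D = (LEAST n. \<exists>Q. feasible P D Q \<and> card Q = n)"

definition thin :: "nat \<Rightarrow> point set \<Rightarrow> bool" where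
  "thin s P \<longleftrightarrow> card (fst ` P) \<le> s"


section \<open>Machine model\<close>

text \<open>
  Algorithms are programs of a first-order, call-by-value language with recursive functions,
  whose data are binary trees with real coordinates at (some of) the leaves. The running time is
  the number of evaluation steps. Each step is a constant number of pointer operations or one
  comparison of two coordinates. There are no real constants and no arithmetic: coordinates can
  only be copied and compared. A polynomial bound on the number of steps therefore
  yields a polynomial-time algorithm both on a real RAM and, for rational coordinates encoded in
  binary, on a Turing machine, the coordinates in the output being copies of input coordinates.
\<close>

datatype val = Leaf | Coord real | Node val val

datatype expr =
    EVar nat
  | ELeaf
  | ENode expr expr
  | EFst expr
  | ESnd expr
  | ELet expr expr
  | EIfNode expr expr expr
  | EIfLess expr expr expr expr
  | ECall nat "expr list"

text \<open>A program is the list of its function bodies; \<open>ECall i\<close> calls the function with index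
  \<open>i\<close>. In a body, \<open>EVar j\<close> is the argument at position \<open>j\<close>; \<open>ELet\<close> binds the new variable at
  position 0 and shifts the others.\<close>

type_synonym program = "expr list"

fun val_fst :: "val \<Rightarrow> val" where
  "val_fst (Node u v) = u"
| "val_fst _ = Leaf"

fun val_snd :: "val \<Rightarrow> val" where
  "val_snd (Node u v) = v"
| "val_snd _ = Leaf"

fun is_node :: "val \<Rightarrow> bool" where
  "is_node (Node u v) = True"
| "is_node _ = False"

fun val_less :: "val \<Rightarrow> val \<Rightarrow> bool" where
  "val_less (Coord a) (Coord b) = (a < b)"
| "val_less _ _ = False"

text \<open>\<open>eval F env e v t\<close>: in program \<open>F\<close> and environment \<open>env\<close>, the expression \<open>e\<close> evaluates to
  \<open>v\<close> in \<open>t\<close> steps.\<close>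

inductive eval :: "program \<Rightarrow> val list \<Rightarrow> expr \<Rightarrow> val \<Rightarrow> nat \<Rightarrow> bool"
  and evals :: "program \<Rightarrow> val list \<Rightarrow> expr list \<Rightarrow> val list \<Rightarrow> nat \<Rightarrow> bool"
  for F :: program
where
  Var: "j < length env \<Longrightarrow> eval F env (EVar j) (env ! j) 1"
| Leaf: "eval F env ELeaf Leaf 1"
| Node: "eval F env e1 v1 t1 \<Longrightarrow> eval F env e2 v2 t2 \<Longrightarrow>
    eval F env (ENode e1 e2) (Node v1 v2) (t1 + t2 + 1)"
| Fst: "eval F env e v t \<Longrightarrow> eval F env (EFst e) (val_fst v) (t + 1)"
| Snd: "eval F env e v t \<Longrightarrow> eval F env (ESnd e) (val_snd v) (t + 1)"
| Let: "eval F env e1 v1 t1 \<Longrightarrow> eval F (v1 # env) e2 v2 t2 \<Longrightarrow>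
    eval F env (ELet e1 e2) v2 (t1 + t2 + 1)"
| IfNode: "eval F env e v t \<Longrightarrow> eval F env (if is_node v then e1 else e2) w u \<Longrightarrow>
    eval F env (EIfNode e e1 e2) w (t + u + 1)"
| IfLess: "eval F env a va ta \<Longrightarrow> eval F env b vb tb \<Longrightarrow>
    eval F env (if val_less va vb then e1 else e2) w u \<Longrightarrow>
    eval F env (EIfLess a b e1 e2) w (ta + tb + u + 1)"
| Call: "i < length F \<Longrightarrow> evals F env es vs t \<Longrightarrow> eval F vs (F ! i) v u \<Longrightarrow>
    eval F env (ECall i es) v (t + u + 1)"
| Empty: "evals F env [] [] 0"
| More: "eval F env e v t \<Longrightarrow> evals F env es vs u \<Longrightarrow> evals F env (e # es) (v # vs) (t + u)"

lemma eval_deterministic: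
  "eval F env e v t \<Longrightarrow> eval F env e v' t' \<Longrightarrow> v = v' \<and> t = t'"
  "evals F env es vs u \<Longrightarrow> evals F env es vs' u' \<Longrightarrow> vs = vs' \<and> u = u'"
proof (induction arbitrary: v' t' and vs' u' rule: eval_evals.inducts)
  case (Var j env) from Var.prems Var.hyps show ?case by (auto elim: eval.cases)
next
  case (Leaf env) from Leaf.prems show ?case by (auto elim: eval.cases)
next
  case (Node env e1 v1 t1 e2 v2 t2)
  from Node.prems show ?case by cases (metis Node.IH)
next
  case (Fst env e v t) from Fst.prems show ?case by cases (metis Fst.IH)
next
  case (Snd env e v t) from Snd.prems show ?case by cases (metis Snd.IH)
next
  case (Let env e1 v1 t1 e2 v2 t2) from Let.prems show ?case by cases (metis Let.IH)
next
  case (IfNode env e v t e1 e2 w u) from IfNode.prems show ?case by cases (metis IfNode.IH)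
next
  case (IfLess env a va ta b vb tb e1 e2 w u)
  from IfLess.prems show ?case by cases (metis IfLess.IH)
next
  case (Call i env es vs t v u) from Call.prems show ?case by cases (metis Call.IH)
next
  case (Empty env) from Empty.prems show ?case by (auto elim: evals.cases)
next
  case (More env e v t es vs u) from More.prems show ?case by cases (metis More.IH)
qed

text \<open>Execution starts with the function of index 0, applied to the input.\<close>

definition computes :: "program \<Rightarrow> val \<Rightarrow> val \<Rightarrow> nat \<Rightarrow> bool" where
  "computes F x y t \<longleftrightarrow> eval F [x] (ECall 0 [EVar 0]) y t"

fun enc_list :: "('a \<Rightarrow> val) \<Rightarrow> 'a list \<Rightarrow> val" where
  "enc_list enc [] = Leaf"
| "enc_list enc (x # xs) = Node (enc x) (enc_list enc xs)"

definition enc_point :: "point \<Rightarrow> val" where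
  "enc_point p = Node (Coord (fst p)) (Coord (snd p))"

definition enc_demand :: "point \<times> point \<Rightarrow> val" where
  "enc_demand d = Node (enc_point (fst d)) (enc_point (snd d))"

definition enc_points :: "point list \<Rightarrow> val" where
  "enc_points ps = enc_list enc_point ps"

definition enc_instance :: "point list \<Rightarrow> (point \<times> point) list \<Rightarrow> val" where
  "enc_instance ps ds = Node (enc_points ps) (enc_list enc_demand ds)"

text \<open>\<open>ps\<close> and \<open>ds\<close> list the sets \<open>P\<close> and \<open>D\<close> without repetition, in an arbitrary order.\<close>

definition lists_instance ::
  "point list \<Rightarrow> (point \<times> point) list \<Rightarrow> point set \<Rightarrow> (point \<times> point) set \<Rightarrow> bool" where
  "lists_instance ps ds P D \<longleftrightarrow> distinct ps \<and> set ps = P \<and> distinct ds \<and> set ds = D"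

end

theory Submission
  imports Defs
begin

text \<open>Every demand with endpoints in different columns contributes the \<open>y\<close>-interval it spans to
  the columns of both endpoints. A path of a feasible solution has to leave (or enter) the column
  horizontally at some height of this interval, which needs a new point because heights are
  distinct in \<open>P\<close>. Hence a maximal family of disjoint intervals in each column, as found by the
  greedy algorithm, has total size at most \<open>2 opt\<close>; the right ends of these intervals stab all
  intervals of the column.

  Now sort the stabbing points \<open>(c, y)\<close> by height and bisect: all columns occurring in the list
  receive a point at the median height, and both halves are treated recursively. A
  demand has a stabbing point in each of its two columns, and the recursion step that separates
  the two supplies a common height for both columns between them, hence inside the demand. A list
  of length \<open>k\<close> costs at most \<open>min k s\<close> at the top, so that only the last \<open>log s\<close> levels
  cost as much as the whole list and the others form a geometric series.\<close>

section \<open>Lower bound\<close>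

lemma l1_dist_triangle: "l1_dist p r \<le> l1_dist p q + l1_dist q r"
  by (auto simp: l1_dist_def)

lemma l1_dist_le_sum:
  "a \<le> b \<Longrightarrow> l1_dist (x a) (x b) \<le> (\<Sum>i\<in>{a..<b}. l1_dist (x i) (x (Suc i)))"
proof (induction b rule: dec_induct)
  case base
  then show ?case by (simp add: l1_dist_def)
next
  case (step n)
  then show ?case using l1_dist_triangle[of "x a" "x (Suc n)" "x n"] by simp
qed

lemma switch_index:
  fixes k :: nat
  assumes "R 0 \<noteq> R k"
  shows "\<exists>i<k. R i \<noteq> R (Suc i)"
proof (rule ccontr)
  assume *: "\<not> ?thesis"
  have "j \<le> k \<Longrightarrow> R j = R 0" for j
  proof (induction j)
    case (Suc j)
    then show ?case using * by (metis Suc_le_lessD less_imp_le)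
  qed simp
  from this[of k] show False using assms by simp
qed

text \<open>Somewhere the path switches between being in column \<open>c\<close> and being outside
  it. That step changes the x-coordinate, so alignment makes it horizontal, and both of its ends are
  points of \<open>X\<close> at the same height.\<close>

lemma M_connected_leaves_column:
  assumes "M_connected X p q" and "(fst p = c) \<noteq> (fst q = c)"
  shows "\<exists>h a. min (snd p) (snd q) \<le> h \<and> h \<le> max (snd p) (snd q) \<and>
           (c, h) \<in> X \<and> (a, h) \<in> X \<and> a \<noteq> c"
proof -
  obtain x k where x: "x 0 = p" "x k = q" "\<forall>i\<le>k. x i \<in> X"
      "\<forall>i<k. aligned (x i) (x (Suc i))"
      "(\<Sum>i<k. l1_dist (x i) (x (Suc i))) = l1_dist p q"
    using assms(1) unfolding M_connected_def by blast
  obtain i where i: "i < k" "(fst (x i) = c) \<noteq> (fst (x (Suc i)) = c)"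
    using switch_index[of "\<lambda>i. fst (x i) = c" k] assms(2) x by auto
  have same: "snd (x i) = snd (x (Suc i))"
    using x(4) i unfolding aligned_def by auto
  have "{..<k} = {0..<i} \<union> {i..<k}" "{0..<i} \<inter> {i..<k} = {}" using i by auto
  then have "(\<Sum>j<k. l1_dist (x j) (x (Suc j))) =
      (\<Sum>j\<in>{0..<i}. l1_dist (x j) (x (Suc j))) + (\<Sum>j\<in>{i..<k}. l1_dist (x j) (x (Suc j)))"
    by (simp add: sum.union_disjoint)
  \<comment> \<open>Cutting the tight path at \<open>x i\<close> leaves no slack in the triangle
    inequality, which in the l1 norm places \<open>x i\<close> in the bounding box of
    \<open>p\<close> and \<open>q\<close>.\<close>
  then have "l1_dist p (x i) + l1_dist (x i) q \<le> l1_dist p q"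
    using l1_dist_le_sum[of 0 i x] l1_dist_le_sum[of i k x] x i by simp
  then have box: "min (snd p) (snd q) \<le> snd (x i)" "snd (x i) \<le> max (snd p) (snd q)"
    unfolding l1_dist_def by linarith+
  have X: "x i \<in> X" "x (Suc i) \<in> X" using x(3) i by auto
  show ?thesis
  proof (cases "fst (x i) = c")
    case True
    then show ?thesis using box X same i
      by (intro exI[of _ "snd (x i)"] exI[of _ "fst (x (Suc i))"])
         (metis prod.collapse)
  next
    case False
    then show ?thesis using box X same i
      by (intro exI[of _ "snd (x i)"] exI[of _ "fst (x i)"]) (metis prod.collapse)
  qed
qed

text \<open>The path goes vertically to height \<open>h\<close>, horizontally across, and vertically
  to \<open>q\<close>. Since \<open>h\<close> lies between the two heights, no leg goes back, so the
  lengths add up to the distance.\<close>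

lemma M_connected_via_height:
  assumes "p \<in> X" "q \<in> X" "(fst p, h) \<in> X" "(fst q, h) \<in> X"
    and "min (snd p) (snd q) \<le> h" "h \<le> max (snd p) (snd q)"
  shows "M_connected X p q"
  unfolding M_connected_def
proof (intro exI conjI)
  let ?x = "\<lambda>i::nat. [p, (fst p, h), (fst q, h), q] ! i"
  have less3: "i < 3 \<longleftrightarrow> i = 0 \<or> i = 1 \<or> i = 2" for i :: nat by auto
  have le3: "i \<le> 3 \<longleftrightarrow> i = 0 \<or> i = 1 \<or> i = 2 \<or> i = 3" for i :: nat by auto
  show "?x 0 = p" "?x 3 = q" by simp_all
  show "\<forall>i\<le>3. ?x i \<in> X" using assms by (auto simp: le3)
  show "\<forall>i<3. aligned (?x i) (?x (Suc i))" by (auto simp: less3 aligned_def)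
  show "(\<Sum>i<3. l1_dist (?x i) (?x (Suc i))) = l1_dist p q"
    using assms(5,6) by (auto simp: l1_dist_def eval_nat_numeral)
qed

lemma M_connected_vertical:
  assumes "p \<in> X" "q \<in> X" "fst p = fst q"
  shows "M_connected X p q"
  using M_connected_via_height[of p X q "snd p"] assms by (metis prod.collapse max.cobounded1 min.cobounded1)

text \<open>States that the points of \<open>Z\<close> are upper ends of demand intervals which are
  pairwise disjoint within each column. The inequality of two equations is an exclusive or: exactly
  one end of the demand lies in the column.\<close>

definition columns_separated :: "(point \<times> point) set \<Rightarrow> point set \<Rightarrow> bool" where
  "columns_separated D Z \<longleftrightarrow> (\<forall>z\<in>Z. \<exists>p q. (p, q) \<in> D \<and> (fst p = fst z) \<noteq> (fst q = fst z) \<and>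
     max (snd p) (snd q) = snd z \<and>
     (\<forall>z'\<in>Z. fst z' = fst z \<and> snd z' < snd z \<longrightarrow> snd z' < min (snd p) (snd q)))"

lemma columns_separatedE:
  assumes "columns_separated D Z" "z \<in> Z"
  obtains p q where "(p, q) \<in> D" "(fst p = fst z) \<noteq> (fst q = fst z)"
    "max (snd p) (snd q) = snd z"
    "\<forall>z'\<in>Z. fst z' = fst z \<and> snd z' < snd z \<longrightarrow> snd z' < min (snd p) (snd q)"
  using bspec[OF assms(1)[unfolded columns_separated_def] assms(2)] by (elim exE conjE)

text \<open>Each \<open>z\<close> is charged to a point of its column where the path of its demand
  crosses horizontally. Crossing points in \<open>Q\<close> number at most \<open>card Q\<close>.
  One outside \<open>Q\<close> lies in \<open>P\<close>, where heights are distinct, so the other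
  end of its horizontal step lies in \<open>Q\<close> at the same height. This gives the factor
  2.\<close>

lemma card_columns_separated:
  assumes sep: "columns_separated D Z" and feas: "feasible P D Q" and inj: "inj_on snd P"
    and fin: "finite Z"
  shows "card Z \<le> 2 * card Q"
proof -
  have finQ: "finite Q" using feas by (simp add: feasible_def)
  have "\<exists>h lo. lo \<le> h \<and> h \<le> snd z \<and> (fst z, h) \<in> P \<union> Q \<and>
      (\<exists>a. a \<noteq> fst z \<and> (a, h) \<in> P \<union> Q) \<and>
      (\<forall>z'\<in>Z. fst z' = fst z \<and> snd z' < snd z \<longrightarrow> snd z' < lo)" if "z \<in> Z" for z
  proof -
    obtain p q where pq: "(p, q) \<in> D" "(fst p = fst z) \<noteq> (fst q = fst z)"
       "max (snd p) (snd q) = snd z"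
       "\<forall>z'\<in>Z. fst z' = fst z \<and> snd z' < snd z \<longrightarrow> snd z' < min (snd p) (snd q)"
      by (rule columns_separatedE[OF sep \<open>z \<in> Z\<close>])
    then have "M_connected (P \<union> Q) p q" using feas by (auto simp: feasible_def)
    from M_connected_leaves_column[OF this pq(2)] obtain h a where
      "min (snd p) (snd q) \<le> h" "h \<le> max (snd p) (snd q)" "(fst z, h) \<in> P \<union> Q"
      "(a, h) \<in> P \<union> Q" "a \<noteq> fst z"
      by blast
    with pq(3,4) show ?thesis
      by (intro exI[of _ h] exI[of _ "min (snd p) (snd q)"] conjI exI[of _ a]) simp_all
  qed
  then obtain h lo where h: "\<And>z. z \<in> Z \<Longrightarrow> lo z \<le> h z \<and> h z \<le> snd z \<and> (fst z, h z) \<in> P \<union> Q \<and>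
      (\<exists>a. a \<noteq> fst z \<and> (a, h z) \<in> P \<union> Q) \<and>
      (\<forall>z'\<in>Z. fst z' = fst z \<and> snd z' < snd z \<longrightarrow> snd z' < lo z)"
    by metis
  define g where "g z = (fst z, h z)" for z :: point
  \<comment> \<open>Disjointness gives the chain \<open>h z\<close> \<le> \<open>snd z\<close> <
    \<open>lo z'\<close> \<le> \<open>h z'\<close>, so crossing points in one column never
    coincide.\<close>
  have ord: "h z < h z'" if "z \<in> Z" "z' \<in> Z" "fst z = fst z'" "snd z < snd z'" for z z'
    using h[OF that(1)] h[OF that(2)] that by force
  have "inj_on g Z"
  proof (rule inj_onI)
    fix z z' assume "z \<in> Z" "z' \<in> Z" "g z = g z'"
    then show "z = z'" using ord[of z z'] ord[of z' z]
      by (cases "snd z" "snd z'" rule: linorder_cases) (auto simp: g_def prod_eq_iff)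
  qed
  then have "card Z = card (g ` Z)" by (simp add: card_image)
  also have "g ` Z = (g ` Z \<inter> Q) \<union> (g ` Z - Q)" by auto
  also have "card \<dots> \<le> card (g ` Z \<inter> Q) + card (g ` Z - Q)" by (rule card_Un_le)
  also have "card (g ` Z \<inter> Q) \<le> card Q" using finQ by (simp add: card_mono)
  also have "card (g ` Z - Q) \<le> card Q"
  proof -
    have sub: "g ` Z - Q \<subseteq> P" using h by (auto simp: g_def)
    have "card (g ` Z - Q) = card (snd ` (g ` Z - Q))"
      using inj sub by (metis card_image inj_on_subset)
    also have "snd ` (g ` Z - Q) \<subseteq> snd ` Q"
    proof
      fix y assume "y \<in> snd ` (g ` Z - Q)"
      then obtain z where z: "z \<in> Z" "g z \<notin> Q" "y = h z" by (auto simp: g_def)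
      then obtain a where a: "a \<noteq> fst z" "(a, h z) \<in> P \<union> Q" using h by blast
      have "g z \<in> P" using z sub by auto
      then have "(a, h z) \<notin> P" using a inj_onD[OF inj, of "(a, h z)" "g z"] by (auto simp: g_def)
      then show "y \<in> snd ` Q" using a z by force
    qed
    then have "card (snd ` (g ` Z - Q)) \<le> card (snd ` Q)" using finQ by (simp add: card_mono)
    also have "\<dots> \<le> card Q" using finQ by (rule card_image_le)
    finally show ?thesis .
  qed
  finally show ?thesis by simp
qed

lemma opt_attained:
  assumes "gmconn_instance P D"
  obtains Q where "feasible P D Q" "card Q = opt P D"
proof -
  let ?Q = "(\<lambda>(p, q). (fst p, snd q)) ` D"
  have "finite D" using assms finite_subset[of D "P \<times> P"] by (auto simp: gmconn_instance_def)
  moreover have "M_connected (P \<union> ?Q) p q" if "(p, q) \<in> D" for p q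
    using assms that
    \<comment> \<open>At height \<open>snd q\<close> the second corner is \<open>q\<close> itself,
      so one new point per demand suffices.\<close>
    by (intro M_connected_via_height[of _ _ _ "snd q"]) (force simp: gmconn_instance_def)+
  ultimately have "feasible P D ?Q" by (auto simp: feasible_def)
  then have "\<exists>n Q. feasible P D Q \<and> card Q = n" by blast
  from LeastI_ex[OF this] show thesis using that unfolding opt_def by blast
qed

section \<open>Greedy stabbing\<close>

text \<open>A triple \<open>(c, lo, hi)\<close>: a column together with the height interval of a
  demand having one end there.\<close>

type_synonym item = "real \<times> real \<times> real"

fun items :: "(point \<times> point) list \<Rightarrow> item list" where
  "items [] = []"
| "items ((p, q) # ds) =
     (let I = (if snd p < snd q then (snd p, snd q) else (snd q, snd p))
      in if fst p = fst q then items ds else (fst p, I) # (fst q, I) # items ds)"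

text \<open>Only the lower end is tested: items are processed by increasing upper end, so no point
  chosen so far lies above the upper end of the current item.\<close>

definition stabbed :: "item \<Rightarrow> point list \<Rightarrow> bool" where
  "stabbed i zs \<longleftrightarrow> (\<exists>z\<in>set zs. fst z = fst i \<and> fst (snd i) \<le> snd z)"

fun greedy :: "item list \<Rightarrow> point list \<Rightarrow> point list" where
  "greedy [] zs = zs"
| "greedy (i # is) zs = greedy is (if stabbed i zs then zs else (fst i, snd (snd i)) # zs)"

lemma set_items:
  "set (items ds) = {(c, min (snd p) (snd q), max (snd p) (snd q)) |c p q.
     (p, q) \<in> set ds \<and> (fst p = c) \<noteq> (fst q = c)}"
proof (induction ds)
  case (Cons d ds)
  obtain p q where d: "d = (p, q)" by (cases d)
  have I: "(if snd p < snd q then (snd p, snd q) else (snd q, snd p)) =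
      (min (snd p) (snd q), max (snd p) (snd q))" by auto
  have N: "{(c, lo, hi) |c. (fst p = c) \<noteq> (fst q = c)} =
      (if fst p = fst q then {} else {(fst p, lo, hi), (fst q, lo, hi)})" for lo hi :: real
  proof -
    have "(fst p = c) \<noteq> (fst q = c) \<longleftrightarrow> fst p \<noteq> fst q \<and> (c = fst p \<or> c = fst q)" for c
      by metis
    then show ?thesis by (simp only:) auto
  qed
  have "set (items (d # ds)) = {(c, min (snd p) (snd q), max (snd p) (snd q)) |c.
      (fst p = c) \<noteq> (fst q = c)} \<union> set (items ds)"
    unfolding N d items.simps I Let_def by (cases "fst p = fst q") simp_all
  also have "\<dots> = {(c, min (snd p) (snd q), max (snd p) (snd q)) |c p q.
     (p, q) \<in> set (d # ds) \<and> (fst p = c) \<noteq> (fst q = c)}"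
    unfolding Cons.IH d by (simp only: list.set insert_iff prod.inject) blast
  finally show ?case .
qed simp

lemma length_items: "length (items ds) \<le> 2 * length ds"
  by (induction ds rule: items.induct) (auto simp: Let_def)

lemma greedy_extends: "set zs \<subseteq> set (greedy is zs)"
  by (induction "is" zs rule: greedy.induct) auto

lemma length_greedy: "length (greedy is zs) \<le> length is + length zs"
  by (induction "is" zs rule: greedy.induct) (fastforce split: if_splits)+

text \<open>Induction along the scan needs an arbitrary accumulator \<open>zs\<close>. The set
  \<open>I\<close> stays fixed while \<open>is\<close> shrinks, so that it still contains the items
  that witnessed points chosen earlier. New points are put in front, hence the descending
  order.\<close>

lemma greedy_invariant:
  assumes "sorted (map (\<lambda>i. snd (snd i)) is)"
    and "\<forall>i\<in>set is. \<forall>z\<in>set zs. snd z \<le> snd (snd i)"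
    and "sorted_wrt (\<lambda>z z'. snd z' \<le> snd z) zs"
    and "\<forall>i\<in>set is. fst (snd i) \<le> snd (snd i)"
    and "distinct zs"
    and "\<forall>z\<in>set zs. \<exists>lo. (fst z, lo, snd z) \<in> I \<and>
           (\<forall>z'\<in>set zs. fst z' = fst z \<and> snd z' < snd z \<longrightarrow> snd z' < lo)"
    and "set is \<subseteq> I"
  shows "sorted_wrt (\<lambda>z z'. snd z' \<le> snd z) (greedy is zs) \<and> distinct (greedy is zs) \<and>
    (\<forall>i\<in>set is. \<exists>z\<in>set (greedy is zs). fst z = fst i \<and> fst (snd i) \<le> snd z \<and> snd z \<le> snd (snd i)) \<and>
    (\<forall>z\<in>set (greedy is zs). \<exists>lo. (fst z, lo, snd z) \<in> I \<and>
           (\<forall>z'\<in>set (greedy is zs). fst z' = fst z \<and> snd z' < snd z \<longrightarrow> snd z' < lo))"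
  using assms
proof (induction "is" zs rule: greedy.induct)
  case (1 zs)
  then show ?case by auto
next
  case (2 i "is" zs)
  define zs' where "zs' = (if stabbed i zs then zs else (fst i, snd (snd i)) # zs)"
  have prems: "\<forall>j\<in>set is. snd (snd i) \<le> snd (snd j)" "\<forall>z\<in>set zs. snd z \<le> snd (snd i)"
    "fst (snd i) \<le> snd (snd i)" "i \<in> I"
    using "2.prems" by auto
  have stab: "\<exists>z\<in>set zs'. fst z = fst i \<and> fst (snd i) \<le> snd z \<and> snd z \<le> snd (snd i)"
    using prems by (auto simp: zs'_def stabbed_def)
  \<comment> \<open>Failure of the test puts all earlier points of this column strictly below the
    item, which is the separation required of the new point.\<close>
  have new: "\<forall>z\<in>set zs. fst z = fst i \<longrightarrow> snd z < fst (snd i)" if "\<not> stabbed i zs"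
    using that by (auto simp: stabbed_def not_le)
  have inv: "\<forall>z\<in>set zs'. \<exists>lo. (fst z, lo, snd z) \<in> I \<and>
           (\<forall>z'\<in>set zs'. fst z' = fst z \<and> snd z' < snd z \<longrightarrow> snd z' < lo)"
  proof (cases "stabbed i zs")
    case True
    then show ?thesis using "2.prems"(6) by (simp add: zs'_def)
  next
    case False
    show ?thesis
    proof
      fix z assume "z \<in> set zs'"
      then consider "z = (fst i, snd (snd i))" | "z \<in> set zs" using False by (auto simp: zs'_def)
      then show "\<exists>lo. (fst z, lo, snd z) \<in> I \<and>
           (\<forall>z'\<in>set zs'. fst z' = fst z \<and> snd z' < snd z \<longrightarrow> snd z' < lo)"
      proof cases
        case 1
        then show ?thesis using new[OF False] False prems
          by (intro exI[of _ "fst (snd i)"]) (auto simp: zs'_def)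
      next
        case 2
        \<comment> \<open>The new point is at least as high as every old one, so it never enters the
          separation condition of an old point.\<close>
        then have "\<not> snd (snd i) < snd z" using prems by (simp add: not_less)
        moreover obtain lo where "(fst z, lo, snd z) \<in> I"
          "\<forall>z'\<in>set zs. fst z' = fst z \<and> snd z' < snd z \<longrightarrow> snd z' < lo"
          using 2 "2.prems"(6) by blast
        ultimately show ?thesis using False by (intro exI[of _ lo]) (auto simp: zs'_def)
      qed
    qed
  qed
  have dist: "distinct zs'"
    using "2.prems"(5) prems new by (force simp: zs'_def)
  have srt: "sorted_wrt (\<lambda>z z'. snd z' \<le> snd z) zs'"
    using "2.prems"(3) prems by (auto simp: zs'_def)
  have le: "\<forall>j\<in>set is. \<forall>z\<in>set zs'. snd z \<le> snd (snd j)"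
    using prems "2.prems"(2) by (auto simp: zs'_def)
  have "sorted (map (\<lambda>i. snd (snd i)) is)" "\<forall>i\<in>set is. fst (snd i) \<le> snd (snd i)" "set is \<subseteq> I"
    using "2.prems" by auto
  note IH = "2.IH"[folded zs'_def, OF this(1) le srt this(2) dist inv this(3)]
  have "greedy (i # is) zs = greedy is zs'" by (simp add: zs'_def)
  moreover have "\<exists>z\<in>set (greedy is zs'). fst z = fst i \<and> fst (snd i) \<le> snd z \<and> snd z \<le> snd (snd i)"
    using stab greedy_extends[of zs' "is"] by blast
  ultimately show ?case using IH by (simp only: list.set ball_simps) blast
qed

text \<open>One scan treats all columns together, since \<open>stabbed\<close> compares points of
  one column only. The common order by upper end also delivers the points sorted by height, as the
  bisection needs.\<close>

definition stabs :: "(point \<times> point) list \<Rightarrow> point list" where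
  "stabs ds = greedy (sort_key (\<lambda>i. snd (snd i)) (items ds)) []"

lemma
  shows sorted_stabs: "sorted_wrt (\<lambda>z z'. snd z' \<le> snd z) (stabs ds)"
    and distinct_stabs: "distinct (stabs ds)"
    and columns_separated_stabs: "columns_separated (set ds) (set (stabs ds))"
    and stabs_stab: "\<lbrakk>(p, q) \<in> set ds; (fst p = c) \<noteq> (fst q = c)\<rbrakk> \<Longrightarrow>
      \<exists>y. (c, y) \<in> set (stabs ds) \<and> min (snd p) (snd q) \<le> y \<and> y \<le> max (snd p) (snd q)"
proof -
  let ?is = "sort_key (\<lambda>i. snd (snd i)) (items ds)"
  have "\<forall>i\<in>set ?is. fst (snd i) \<le> snd (snd i)" by (auto simp: set_items)
  then have *: "sorted_wrt (\<lambda>z z'. snd z' \<le> snd z) (stabs ds) \<and> distinct (stabs ds) \<and>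
    (\<forall>i\<in>set ?is. \<exists>z\<in>set (stabs ds). fst z = fst i \<and> fst (snd i) \<le> snd z \<and> snd z \<le> snd (snd i)) \<and>
    (\<forall>z\<in>set (stabs ds). \<exists>lo. (fst z, lo, snd z) \<in> set (items ds) \<and>
           (\<forall>z'\<in>set (stabs ds). fst z' = fst z \<and> snd z' < snd z \<longrightarrow> snd z' < lo))"
    unfolding stabs_def by (intro greedy_invariant) auto
  then show "sorted_wrt (\<lambda>z z'. snd z' \<le> snd z) (stabs ds)" "distinct (stabs ds)" by auto
  show "columns_separated (set ds) (set (stabs ds))"
    unfolding columns_separated_def
  proof
    fix z assume "z \<in> set (stabs ds)"
    then obtain lo where lo: "(fst z, lo, snd z) \<in> set (items ds)"
        "\<forall>z'\<in>set (stabs ds). fst z' = fst z \<and> snd z' < snd z \<longrightarrow> snd z' < lo"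
      using * by blast
    from lo(1) obtain p q where "(p, q) \<in> set ds" "(fst p = fst z) \<noteq> (fst q = fst z)"
       "lo = min (snd p) (snd q)" "snd z = max (snd p) (snd q)"
      unfolding set_items by blast
    then show "\<exists>p q. (p, q) \<in> set ds \<and> (fst p = fst z) \<noteq> (fst q = fst z) \<and>
     max (snd p) (snd q) = snd z \<and>
     (\<forall>z'\<in>set (stabs ds). fst z' = fst z \<and> snd z' < snd z \<longrightarrow> snd z' < min (snd p) (snd q))"
      using lo(2) by (intro exI[of _ p] exI[of _ q]) auto
  qed
  assume "(p, q) \<in> set ds" "(fst p = c) \<noteq> (fst q = c)"
  then have "(c, min (snd p) (snd q), max (snd p) (snd q)) \<in> set ?is"
    unfolding set_sort set_items by blast
  then obtain z where "z \<in> set (stabs ds)" "fst z = c" "min (snd p) (snd q) \<le> snd z"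
      "snd z \<le> max (snd p) (snd q)"
    using * by fastforce
  then show "\<exists>y. (c, y) \<in> set (stabs ds) \<and> min (snd p) (snd q) \<le> y \<and> y \<le> max (snd p) (snd q)"
    by (intro exI[of _ "snd z"]) (metis prod.collapse)
qed

section \<open>Bisection\<close>

text \<open>Columns with several stabbing points yield repeated points; sizes are therefore measured
  on \<open>set (bisect zs)\<close>.\<close>

function bisect :: "point list \<Rightarrow> point list" where
  "bisect zs = (if length zs < 2 then [] else
     map (\<lambda>z. (fst z, snd (zs ! (length zs div 2)))) zs @
     bisect (take (length zs div 2) zs) @ bisect (drop (length zs div 2) zs))"
  by auto
termination by (relation "measure length") auto

declare bisect.simps [simp del]

text \<open>Two entries in the same half are handled by recursion. Otherwise the median height lies
  between them and is given to both columns. The recursion cannot stop earlier, because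
  \<open>c\<close> \<noteq> \<open>d\<close> makes the entries distinct.\<close>

lemma bisect_common_height:
  assumes "sorted_wrt (\<lambda>z z'. snd z' \<le> snd z) zs"
    and "(c, y) \<in> set zs" "(d, y') \<in> set zs" "c \<noteq> d"
  shows "\<exists>h. min y y' \<le> h \<and> h \<le> max y y' \<and> (c, h) \<in> set (bisect zs) \<and> (d, h) \<in> set (bisect zs)"
  using assms
proof (induction zs rule: bisect.induct)
  case (1 zs)
  define k where "k = length zs div 2"
  define h where "h = snd (zs ! k)"
  have len: "\<not> length zs < 2"
  proof
    assume "length zs < 2"
    then consider "zs = []" | z where "zs = [z]" by (cases zs; cases "tl zs") auto
    then show False using "1.prems" by cases auto
  qed
  have bis: "bisect zs = map (\<lambda>z. (fst z, h)) zs @ bisect (take k zs) @ bisect (drop k zs)"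
    using len by (subst bisect.simps) (simp add: k_def h_def)
  have split: "set zs = set (take k zs) \<union> set (drop k zs)"
    by (metis append_take_drop_id set_append)
  have srt: "sorted_wrt (\<lambda>z z'. snd z' \<le> snd z) (take k zs)"
      "sorted_wrt (\<lambda>z z'. snd z' \<le> snd z) (drop k zs)"
    using "1.prems"(1) by (simp_all add: sorted_wrt_take sorted_wrt_drop)
  have k: "k < length zs" using len by (simp add: k_def)
  \<comment> \<open>The median is the head of the rear half: heights in front are at least
    \<open>h\<close>, those in the rear at most \<open>h\<close>.\<close>
  have drop_eq: "drop k zs = zs ! k # drop (Suc k) zs" by (rule Cons_nth_drop_Suc[OF k, symmetric])
  have front: "h \<le> snd z" if "z \<in> set (take k zs)" for z
  proof -
    have "sorted_wrt (\<lambda>z z'. snd z' \<le> snd z) (take k zs @ drop k zs)" using "1.prems"(1) by simp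
    then show ?thesis using that unfolding sorted_wrt_append by (simp add: drop_eq h_def)
  qed
  have rear: "snd z \<le> h" if "z \<in> set (drop k zs)" for z
    using srt(2) that by (auto simp: drop_eq h_def)
  have emitted: "(c, h) \<in> set (bisect zs)" "(d, h) \<in> set (bisect zs)"
    using "1.prems" by (force simp: bis)+
  consider "(c, y) \<in> set (take k zs)" "(d, y') \<in> set (take k zs)"
    | "(c, y) \<in> set (drop k zs)" "(d, y') \<in> set (drop k zs)"
    | "min y y' \<le> h" "h \<le> max y y'"
    using "1.prems"(2,3) front rear unfolding split by fastforce
  then show ?case
  proof cases
    case 1
    from "1.IH"(1)[OF len, folded k_def, OF srt(1) 1 \<open>c \<noteq> d\<close>] show ?thesis by (auto simp: bis)
  next
    case 2
    from "1.IH"(2)[OF len, folded k_def, OF srt(2) 2 \<open>c \<noteq> d\<close>] show ?thesis by (auto simp: bis)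
  next
    case 3
    then show ?thesis using emitted by blast
  qed
qed

section \<open>Counting the points placed by the bisection\<close>

lemma card_bisect_step:
  assumes "\<not> length zs < 2"
  shows "card (set (bisect zs)) \<le> card (fst ` set zs) +
    card (set (bisect (take (length zs div 2) zs))) + card (set (bisect (drop (length zs div 2) zs)))"
proof -
  define k where "k = length zs div 2"
  \<comment> \<open>All points of this level share one height, so they are determined by their
    columns.\<close>
  have "set (bisect zs) = (\<lambda>c. (c, snd (zs ! k))) ` fst ` set zs \<union>
      (set (bisect (take k zs)) \<union> set (bisect (drop k zs)))"
    using assms by (subst bisect.simps) (auto simp: k_def image_image)
  then have "card (set (bisect zs)) \<le> card ((\<lambda>c. (c, snd (zs ! k))) ` fst ` set zs) +
      (card (set (bisect (take k zs))) + card (set (bisect (drop k zs))))"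
    by (metis (no_types, lifting) card_Un_le add_left_mono le_trans)
  moreover have "card ((\<lambda>c. (c, snd (zs ! k))) ` fst ` set zs) \<le> card (fst ` set zs)"
    by (simp add: card_image_le)
  ultimately show ?thesis by (simp add: k_def)
qed

text \<open>There are at most \<open>j\<close> levels of recursion, and the lists of one level have
  total length at most \<open>length zs\<close>.\<close>

lemma card_bisect_short: "length zs \<le> 2 ^ j \<Longrightarrow> card (set (bisect zs)) \<le> j * length zs"
proof (induction j arbitrary: zs)
  case 0
  then show ?case by (subst bisect.simps) simp
next
  case (Suc j)
  define k where "k = length zs div 2"
  show ?case
  proof (cases "length zs < 2")
    case True
    then show ?thesis by (subst bisect.simps) simp
  next
    case False
    have len: "length (take k zs) = k" "length (drop k zs) = length zs - k"
      by (simp_all add: k_def)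
    have "card (set (bisect (take k zs))) \<le> j * k"
      using Suc.IH[of "take k zs"] Suc.prems len by (simp add: k_def)
    moreover have "card (set (bisect (drop k zs))) \<le> j * (length zs - k)"
      using Suc.IH[of "drop k zs"] Suc.prems len by (simp add: k_def)
    moreover have "card (fst ` set zs) \<le> length zs"
      by (metis card_length length_map list.set_map)
    moreover have "j * k + j * (length zs - k) = j * length zs"
      by (simp add: k_def flip: distrib_left)
    ultimately show ?thesis using card_bisect_step[OF False] by (simp add: k_def)
  qed
qed

text \<open>The term \<open>s\<close> on the left of the inequality pays for the next bisection step.\<close>

lemma card_bisect_long:
  assumes "s \<le> 2 ^ j" "card (fst ` set zs) \<le> s" "s \<le> 2 * length zs"
  shows "card (set (bisect zs)) + s \<le> (j + 2) * length zs"
  using assms(2,3)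
proof (induction zs rule: bisect.induct)
  case (1 zs)
  define k where "k = length zs div 2"
  show ?case
  proof (cases "length zs \<le> 2 ^ j \<or> length zs < 2")
    case True
    then have "card (set (bisect zs)) \<le> j * length zs"
    proof
      assume "length zs < 2" then show ?thesis by (subst bisect.simps) simp
    qed (rule card_bisect_short)
    \<comment> \<open>The premise \<open>s\<close> \<le> \<open>2 * length zs\<close> lets the
      summand 2 in \<open>j + 2\<close> pay for the extra \<open>s\<close>.\<close>
    then show ?thesis using "1.prems" by simp
  next
    case False
    have col: "card (fst ` set (take k zs)) \<le> s" "card (fst ` set (drop k zs)) \<le> s"
      using "1.prems"(1) set_take_subset[of k zs] set_drop_subset[of k zs]
      by (meson List.finite_set card_mono finite_imageI image_mono le_trans)+
    have len: "length (take k zs) = k" "length (drop k zs) = length zs - k"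
      by (simp_all add: k_def)
    \<comment> \<open>Strictness matters for odd lengths: it gives \<open>s\<close> \<le>
      \<open>2 * k\<close> even though \<open>k\<close> is rounded down, so both halves meet the
      premise of the induction.\<close>
    have gt: "s < length zs" using False assms(1) by simp
    have "card (set (bisect (take k zs))) + s \<le> (j + 2) * k"
      using "1.IH"(1)[folded k_def, OF _ col(1)] False gt len by (simp add: k_def)
    moreover have "card (set (bisect (drop k zs))) + s \<le> (j + 2) * (length zs - k)"
      using "1.IH"(2)[folded k_def, OF _ col(2)] False gt len by (simp add: k_def)
    moreover have "(j + 2) * k + (j + 2) * (length zs - k) = (j + 2) * length zs"
      by (simp only: flip: distrib_left) (simp add: k_def)
    moreover have "card (set (bisect zs)) \<le> card (fst ` set zs) +
        card (set (bisect (take k zs))) + card (set (bisect (drop k zs)))"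
      using card_bisect_step[of zs] False by (simp add: k_def)
    \<comment> \<open>The halves provide \<open>s\<close> twice: one covers the columns of the
      current level, the other is the surplus to be kept.\<close>
    ultimately show ?thesis using "1.prems"(1) by linarith
  qed
qed

lemma card_bisect:
  assumes "s \<le> 2 ^ j" "card (fst ` set zs) \<le> s"
  shows "card (set (bisect zs)) \<le> (j + 2) * length zs"
proof (cases "s \<le> 2 * length zs")
  case True
  then show ?thesis using card_bisect_long[OF assms] by simp
next
  case False
  then have "length zs \<le> 2 ^ j" using assms by simp
  then show ?thesis using card_bisect_short[of zs j] by simp
qed

section \<open>Approximation guarantee\<close>

lemma feasible_bisect_stabs:
  assumes "gmconn_instance P (set ds)"
  shows "feasible P (set ds) (set (bisect (stabs ds)))"
proof -
  have "M_connected (P \<union> set (bisect (stabs ds))) p q" if pq: "(p, q) \<in> set ds" for p q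
  proof (cases "fst p = fst q")
    case True
    then show ?thesis using assms pq
      by (intro M_connected_vertical) (auto simp: gmconn_instance_def)
  next
    case False
    obtain y where y: "(fst p, y) \<in> set (stabs ds)"
        "min (snd p) (snd q) \<le> y" "y \<le> max (snd p) (snd q)"
      using stabs_stab[OF pq, of "fst p"] False by auto
    obtain y' where y': "(fst q, y') \<in> set (stabs ds)"
        "min (snd p) (snd q) \<le> y'" "y' \<le> max (snd p) (snd q)"
      using stabs_stab[OF pq, of "fst q"] False by auto
    obtain h where "min y y' \<le> h" "h \<le> max y y'"
        "(fst p, h) \<in> set (bisect (stabs ds))" "(fst q, h) \<in> set (bisect (stabs ds))"
      using bisect_common_height[OF sorted_stabs y(1) y'(1) False] by blast
    then show ?thesis using assms pq y y'
      by (intro M_connected_via_height[of _ _ _ h]) (auto simp: gmconn_instance_def)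
  qed
  then show ?thesis by (auto simp: feasible_def)
qed

lemma stabs_columns:
  assumes "gmconn_instance P (set ds)"
  shows "fst ` set (stabs ds) \<subseteq> fst ` P"
proof
  fix c assume "c \<in> fst ` set (stabs ds)"
  then obtain z where z: "z \<in> set (stabs ds)" "fst z = c" by blast
  obtain p q where "(p, q) \<in> set ds" "fst p = c \<or> fst q = c"
    by (rule columns_separatedE[OF columns_separated_stabs z(1)]) (use z(2) in blast)
  then show "c \<in> fst ` P" using assms by (auto simp: gmconn_instance_def)
qed

lemma card_bisect_stabs:
  assumes inst: "gmconn_instance P (set ds)" and thin: "thin s P" and "1 \<le> s"
  shows "real (card (set (bisect (stabs ds)))) \<le> 8 * log 2 (real s) * real (opt P (set ds))"
\<comment> \<open>For \<open>s = 1\<close> the bound is 0, so nothing may be output: a stabbing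
  point would require a demand between two different columns.\<close>
proof (cases "s = 1")
  case True
  have "stabs ds = []"
  proof (rule ccontr)
    assume "stabs ds \<noteq> []"
    then obtain z where "z \<in> set (stabs ds)" by (meson list.set_sel(1))
    then obtain p q where pq: "(p, q) \<in> set ds" "fst p \<noteq> fst q"
      by (metis columns_separatedE[OF columns_separated_stabs])
    then have "{fst p, fst q} \<subseteq> fst ` P" using inst by (auto simp: gmconn_instance_def)
    then have "card {fst p, fst q} \<le> card (fst ` P)"
      using inst by (intro card_mono) (auto simp: gmconn_instance_def)
    then show False using thin True pq by (simp add: thin_def)
  qed
  then show ?thesis using True by (simp add: bisect.simps)
next
  case False
  define j where "j = nat \<lceil>log 2 (real s)\<rceil>"
  have s: "s \<ge> 2" using False \<open>1 \<le> s\<close> by simp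
  then have log1: "1 \<le> log 2 (real s)" by (simp add: le_log_iff)
  then have j: "log 2 (real s) \<le> real j" "real j \<le> log 2 (real s) + 1"
    unfolding j_def by linarith+
  have "real s \<le> 2 powr real j" using j(1) s by (simp add: log_le_iff)
  then have "real s \<le> real (2 ^ j)" by (simp add: powr_realpow)
  then have pow: "s \<le> 2 ^ j" by (simp only: of_nat_le_iff)
  have "card (fst ` set (stabs ds)) \<le> card (fst ` P)"
    using stabs_columns[OF inst] inst by (intro card_mono) (auto simp: gmconn_instance_def)
  then have "card (fst ` set (stabs ds)) \<le> s" using thin by (simp add: thin_def)
  from card_bisect[OF pow this]
  have "card (set (bisect (stabs ds))) \<le> (j + 2) * length (stabs ds)" .
  also have "length (stabs ds) \<le> 2 * opt P (set ds)"
  proof -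
    obtain Q where Q: "feasible P (set ds) Q" "card Q = opt P (set ds)"
      using opt_attained[OF inst] .
    have "card (set (stabs ds)) \<le> 2 * card Q"
      using inst by (intro card_columns_separated[OF columns_separated_stabs Q(1)])
        (auto simp: gmconn_instance_def)
    then show ?thesis using Q(2) distinct_card[OF distinct_stabs] by metis
  qed
  finally have "card (set (bisect (stabs ds))) \<le> (j + 2) * (2 * opt P (set ds))"
    by (simp only: mult_le_mono2)
  then have "real (card (set (bisect (stabs ds)))) \<le> real ((j + 2) * (2 * opt P (set ds)))"
    by (simp only: of_nat_le_iff)
  also have "\<dots> = (2 * real j + 4) * real (opt P (set ds))" by (simp add: algebra_simps)
  \<comment> \<open>Rounding up costs at most 1, so \<open>2 * j + 4\<close> is at most
    \<open>2 * log 2 s + 6\<close>; the constant is absorbed because the logarithm is at least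
    1.\<close>
  also have "\<dots> \<le> (8 * log 2 (real s)) * real (opt P (set ds))"
    using j log1 by (intro mult_right_mono) auto
  finally show ?thesis .
qed

section \<open>The program\<close>

text \<open>In continuation-passing style evaluation satisfies equations, by which the
  simplifier executes a function body symbolically; \<open>run_eval\<close> covers the calls.\<close>

definition run :: "program \<Rightarrow> val list \<Rightarrow> expr \<Rightarrow> (val \<Rightarrow> nat \<Rightarrow> bool) \<Rightarrow> bool" where
  "run F env e K \<longleftrightarrow> (\<exists>v t. eval F env e v t \<and> K v t)"

definition runs :: "program \<Rightarrow> val list \<Rightarrow> expr list \<Rightarrow> (val list \<Rightarrow> nat \<Rightarrow> bool) \<Rightarrow> bool" where
  "runs F env es K \<longleftrightarrow> (\<exists>vs t. evals F env es vs t \<and> K vs t)"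

text \<open>By determinism the known evaluation is the only one, so the specification of a called
  function becomes a rewrite rule.\<close>

lemma run_eval: "eval F env e v t \<Longrightarrow> run F env e K \<longleftrightarrow> K v t"
  unfolding run_def by (metis eval_deterministic(1))

inductive_simps eval_simps:
  "eval F env (EVar j) v t"
  "eval F env ELeaf v t"
  "eval F env (ENode e1 e2) v t"
  "eval F env (EFst e) v t"
  "eval F env (ESnd e) v t"
  "eval F env (ELet e1 e2) v t"
  "eval F env (EIfNode e e1 e2) v t"
  "eval F env (EIfLess a b e1 e2) v t"
  "eval F env (ECall i es) v t"
  "evals F env [] vs t"
  "evals F env (e # es) vs t"

lemma run_simps [simp]:
  "j < length env \<Longrightarrow> run F env (EVar j) K \<longleftrightarrow> K (env ! j) 1"
  "run F env ELeaf K \<longleftrightarrow> K Leaf 1"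
  "run F env (ENode e1 e2) K \<longleftrightarrow>
     run F env e1 (\<lambda>v1 t1. run F env e2 (\<lambda>v2 t2. K (Node v1 v2) (t1 + t2 + 1)))"
  "run F env (EFst e) K \<longleftrightarrow> run F env e (\<lambda>v t. K (val_fst v) (t + 1))"
  "run F env (ESnd e) K \<longleftrightarrow> run F env e (\<lambda>v t. K (val_snd v) (t + 1))"
  "run F env (ELet e1 e2) K \<longleftrightarrow>
     run F env e1 (\<lambda>v1 t1. run F (v1 # env) e2 (\<lambda>v2 t2. K v2 (t1 + t2 + 1)))"
  "run F env (EIfNode e e1 e2) K \<longleftrightarrow>
     run F env e (\<lambda>v t. run F env (if is_node v then e1 else e2) (\<lambda>w u. K w (t + u + 1)))"
  "run F env (EIfLess a b e1 e2) K \<longleftrightarrow>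
     run F env a (\<lambda>va ta. run F env b (\<lambda>vb tb.
       run F env (if val_less va vb then e1 else e2) (\<lambda>w u. K w (ta + tb + u + 1))))"
  "i < length F \<Longrightarrow> run F env (ECall i es) K \<longleftrightarrow>
     runs F env es (\<lambda>vs t. run F vs (F ! i) (\<lambda>v u. K v (t + u + 1)))"
  "runs F env [] L \<longleftrightarrow> L [] 0"
  "runs F env (e # es) L \<longleftrightarrow> run F env e (\<lambda>v t. runs F env es (\<lambda>vs u. L (v # vs) (t + u)))"
  unfolding run_def runs_def by (subst eval_simps; (blast | fastforce))+

lemma run_if [simp]:
  "run F env (if b then e1 else e2) K \<longleftrightarrow> (if b then run F env e1 K else run F env e2 K)"
  by simp

lemma run_bounded: "run F env e (\<lambda>v t. v = w \<and> t \<le> B) \<Longrightarrow> \<exists>t\<le>B. eval F env e w t"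
  unfolding run_def by blast

section \<open>Encoded items and the function bodies\<close>

fun enc_item :: "item \<Rightarrow> val" where
  "enc_item (c, lo, hi) = Node (Coord c) (Node (Coord lo) (Coord hi))"

text \<open>Function indices: 1 items, 2 insertion, 3 sorting, 4 stabbing test, 5 greedy scan, 6
  halving, 7 emission of a level, 8 bisection. The two \<open>ELeaf\<close> arguments are empty
  accumulators.\<close>

definition main_body :: expr where
  "main_body = ECall 8 [ECall 5 [ECall 3 [ECall 1 [ESnd (EVar 0)]], ELeaf], ELeaf]"

text \<open>Under the four bindings, variables 0 to 3 are the interval, \<open>q\<close>,
  \<open>p\<close> and the items of the remaining demands. Equality of columns is recognised by the
  failure of both strict comparisons.\<close>

definition items_body :: expr where
  "items_body = EIfNode (EVar 0)
     (ELet (ECall 1 [ESnd (EVar 0)])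
     (ELet (EFst (EFst (EVar 1)))
     (ELet (ESnd (EFst (EVar 2)))
     (ELet (EIfLess (ESnd (EVar 1)) (ESnd (EVar 0))
              (ENode (ESnd (EVar 1)) (ESnd (EVar 0))) (ENode (ESnd (EVar 0)) (ESnd (EVar 1))))
       (let both = ENode (ENode (EFst (EVar 2)) (EVar 0))
                     (ENode (ENode (EFst (EVar 1)) (EVar 0)) (EVar 3))
        in EIfLess (EFst (EVar 2)) (EFst (EVar 1)) both
             (EIfLess (EFst (EVar 1)) (EFst (EVar 2)) both (EVar 3)))))))
     ELeaf"

definition insort_body :: expr where
  "insort_body = EIfNode (EVar 1)
     (EIfLess (ESnd (ESnd (EFst (EVar 1)))) (ESnd (ESnd (EVar 0)))
       (ENode (EFst (EVar 1)) (ECall 2 [EVar 0, ESnd (EVar 1)]))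
       (ENode (EVar 0) (EVar 1)))
     (ENode (EVar 0) ELeaf)"

definition sort_body :: expr where
  "sort_body = EIfNode (EVar 0) (ECall 2 [EFst (EVar 0), ECall 3 [ESnd (EVar 0)]]) ELeaf"

text \<open>Truth is returned as a node and falsity as a leaf. A point is skipped if it is too low
  or lies in another column; passing all three strict tests means that it stabs.\<close>

definition stabbed_body :: expr where
  "stabbed_body = EIfNode (EVar 1)
     (let next = ECall 4 [EVar 0, ESnd (EVar 1)]
      in EIfLess (ESnd (EFst (EVar 1))) (EFst (ESnd (EVar 0))) next
        (EIfLess (EFst (EFst (EVar 1))) (EFst (EVar 0)) next
        (EIfLess (EFst (EVar 0)) (EFst (EFst (EVar 1))) next (ENode ELeaf ELeaf))))
     ELeaf"

definition greedy_body :: expr where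
  "greedy_body = EIfNode (EVar 0)
     (ECall 5 [ESnd (EVar 0), EIfNode (ECall 4 [EFst (EVar 0), EVar 1]) (EVar 1)
        (ENode (ENode (EFst (EFst (EVar 0))) (ESnd (ESnd (EFst (EVar 0))))) (EVar 1))])
     (EVar 1)"

text \<open>Halving a list: the second argument initially is the same list, and two of its elements are
  dropped for each element of the first argument that is moved to the front half.\<close>

definition halve_body :: expr where
  "halve_body = EIfNode (EVar 1)
     (EIfNode (ESnd (EVar 1))
       (ELet (ECall 6 [ESnd (EVar 0), ESnd (ESnd (EVar 1))])
         (ENode (ENode (EFst (EVar 1)) (EFst (EVar 0))) (ESnd (EVar 0))))
       (ENode ELeaf (EVar 0)))
     (ENode ELeaf (EVar 0))"

definition emit_body :: expr where
  "emit_body = EIfNode (EVar 1)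
     (ENode (ENode (EFst (EFst (EVar 1))) (EVar 0)) (ECall 7 [EVar 0, ESnd (EVar 1), EVar 2]))
     (EVar 2)"

text \<open>The median is read off as the head of the rear half. Passing the output of one call on
  as the accumulator of the next avoids appending lists.\<close>

definition bisect_body :: expr where
  "bisect_body = EIfNode (EVar 0)
     (EIfNode (ESnd (EVar 0))
       (ELet (ECall 6 [EVar 0, EVar 0])
         (ECall 7 [ESnd (EFst (ESnd (EVar 0))), EVar 1,
            ECall 8 [EFst (EVar 0), ECall 8 [ESnd (EVar 0), EVar 2]]]))
       (EVar 1))
     (EVar 1)"

definition prog :: program where
  "prog = [main_body, items_body, insort_body, sort_body, stabbed_body, greedy_body, halve_body,
     emit_body, bisect_body]"

lemma length_prog [simp]: "length prog = 9"
  by (simp add: prog_def)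

lemma prog_nth:
  "prog ! 0 = main_body" "prog ! Suc 0 = items_body" "prog ! 2 = insort_body"
  "prog ! 3 = sort_body" "prog ! 4 = stabbed_body" "prog ! 5 = greedy_body"
  "prog ! 6 = halve_body" "prog ! 7 = emit_body" "prog ! 8 = bisect_body"
  by (simp_all add: prog_def)

section \<open>Correctness and step counts of the functions\<close>

lemma eval_items:
  "\<exists>t\<le>60 * length ds + 5. eval prog [enc_list enc_demand ds] (prog ! Suc 0)
     (enc_list enc_item (items ds)) t"
proof (induction ds)
  case Nil
  show ?case by (rule run_bounded, subst prog_nth, unfold items_body_def) simp
next
  case (Cons d ds)
  obtain p q where d: "d = (p, q)" by (cases d)
  from Cons.IH obtain t where t: "t \<le> 60 * length ds + 5"
    "eval prog [enc_list enc_demand ds] (prog ! Suc 0) (enc_list enc_item (items ds)) t" by blast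
  show ?case
    \<comment> \<open>\<open>prog_nth\<close> is applied once only: the recursive call keeps the
      form \<open>prog ! Suc 0\<close>, to which the evaluation from the induction hypothesis
      applies.\<close>
    by (rule run_bounded, subst prog_nth, unfold items_body_def)
      (use t(1) in \<open>auto simp: d enc_demand_def enc_point_def Let_def run_eval[OF t(2)]\<close>)
qed

lemma eval_insort:
  "\<exists>t\<le>30 * length is + 10. eval prog [enc_item i, enc_list enc_item is] (prog ! 2)
     (enc_list enc_item (insort_key (\<lambda>i. snd (snd i)) i is)) t"
proof (induction "is")
  case Nil
  show ?case by (rule run_bounded, subst prog_nth, unfold insort_body_def) simp
next
  case (Cons j "is")
  obtain c lo hi c' lo' hi' where ij: "i = (c, lo, hi)" "j = (c', lo', hi')"
    by (cases i, cases j)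
  from Cons.IH obtain t where t: "t \<le> 30 * length is + 10"
    "eval prog [enc_item i, enc_list enc_item is] (prog ! 2)
       (enc_list enc_item (insort_key (\<lambda>i. snd (snd i)) i is)) t" by blast
  show ?case
    by (rule run_bounded, subst prog_nth, unfold insort_body_def)
      (use t(1) in \<open>auto simp: ij run_eval[OF t(2)[unfolded ij enc_item.simps]]\<close>)
qed

lemma eval_sort:
  "\<exists>t\<le>40 * (length is + 1)\<^sup>2. eval prog [enc_list enc_item is] (prog ! 3)
     (enc_list enc_item (sort_key (\<lambda>i. snd (snd i)) is)) t"
proof (induction "is")
  case Nil
  show ?case by (rule run_bounded, subst prog_nth, unfold sort_body_def) simp
next
  case (Cons i "is")
  from Cons.IH obtain t where t: "t \<le> 40 * (length is + 1)\<^sup>2"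
    "eval prog [enc_list enc_item is] (prog ! 3)
     (enc_list enc_item (sort_key (\<lambda>i. snd (snd i)) is)) t" by blast
  obtain u where u: "u \<le> 30 * length is + 10"
    "eval prog [enc_item i, enc_list enc_item (sort_key (\<lambda>i. snd (snd i)) is)] (prog ! 2)
     (enc_list enc_item (sort_key (\<lambda>i. snd (snd i)) (i # is))) u"
    using eval_insort[of "sort_key (\<lambda>i. snd (snd i)) is" i] by auto
  show ?case
    by (rule run_bounded, subst prog_nth, unfold sort_body_def)
      (use t(1) u(1) in \<open>simp add: run_eval[OF t(2)] run_eval[OF u(2)[unfolded sort_key_simps]]
         power2_eq_square\<close>)
qed

lemma eval_stabbed:
  "\<exists>t\<le>40 * length zs + 5. eval prog [enc_item i, enc_points zs] (prog ! 4)
     (if stabbed i zs then Node Leaf Leaf else Leaf) t"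
proof (induction zs)
  case Nil
  show ?case
    by (rule run_bounded, subst prog_nth, unfold stabbed_body_def)
      (simp add: enc_points_def stabbed_def)
next
  case (Cons z zs)
  obtain c lo hi where i: "i = (c, lo, hi)" by (cases i)
  from Cons.IH obtain t where t: "t \<le> 40 * length zs + 5"
    "eval prog [enc_item i, enc_points zs] (prog ! 4)
     (if stabbed i zs then Node Leaf Leaf else Leaf) t" by blast
  have step: "stabbed i (z # zs) \<longleftrightarrow> fst z = c \<and> lo \<le> snd z \<or> stabbed i zs"
    by (simp add: stabbed_def i)
  show ?case
    unfolding step
    by (rule run_bounded, subst prog_nth, unfold stabbed_body_def)
      (use t(1) in \<open>auto simp: enc_points_def enc_point_def i Let_def
         run_eval[OF t(2)[unfolded enc_points_def i enc_item.simps]]\<close>)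
qed

text \<open>Each of the \<open>length is\<close> rounds scans the accumulator, which grows by at
  most one point per round and so never exceeds \<open>length is + length zs\<close>.\<close>

lemma eval_greedy:
  "\<exists>t\<le>50 * length is * (length is + length zs + 1) + 4.
     eval prog [enc_list enc_item is, enc_points zs] (prog ! 5) (enc_points (greedy is zs)) t"
proof (induction "is" zs rule: greedy.induct)
  case (1 zs)
  show ?case by (rule run_bounded, subst prog_nth, unfold greedy_body_def) simp
next
  case (2 i "is" zs)
  obtain c lo hi where i: "i = (c, lo, hi)" by (cases i)
  define zs' where "zs' = (if stabbed i zs then zs else (fst i, snd (snd i)) # zs)"
  from "2.IH" obtain t where t: "t \<le> 50 * length is * (length is + length zs' + 1) + 4"
    "eval prog [enc_list enc_item is, enc_points zs'] (prog ! 5) (enc_points (greedy is zs')) t"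
    unfolding zs'_def by blast
  obtain u where u: "u \<le> 40 * length zs + 5" "eval prog [enc_item i, enc_points zs] (prog ! 4)
     (if stabbed i zs then Node Leaf Leaf else Leaf) u"
    using eval_stabbed by blast
  have "length zs' \<le> Suc (length zs)" by (simp add: zs'_def)
  then have "50 * length is * (length is + length zs' + 1) \<le> 50 * length is * (length is + length zs + 2)"
    by (intro mult_le_mono2) simp
  with t(1) have t1: "t \<le> 50 * length is * (length is + length zs + 2) + 4" by simp
  show ?case
  proof (cases "stabbed i zs")
    case True
    then have "zs' = zs" by (simp add: zs'_def)
    note t2 = t(2)[unfolded this]
    show ?thesis
      by (rule run_bounded, subst prog_nth, unfold greedy_body_def)
        (use t1 u(1) True in \<open>simp add: run_eval[OF u(2)] run_eval[OF t2] algebra_simps\<close>)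
  next
    case False
    then have "zs' = (c, hi) # zs" by (simp add: zs'_def i)
    with t(2) have t2: "eval prog [enc_list enc_item is,
        Node (Node (Coord c) (Coord hi)) (enc_list enc_point zs)] (prog ! 5)
        (enc_list enc_point (greedy is ((c, hi) # zs))) t"
      by (simp add: enc_points_def enc_point_def)
    show ?thesis
      by (rule run_bounded, subst prog_nth, unfold greedy_body_def)
        (use t1 u(1) False in \<open>simp add: i enc_points_def
           run_eval[OF u(2)[unfolded i enc_item.simps enc_points_def]] run_eval[OF t2] algebra_simps\<close>)
  qed
qed

text \<open>The two arguments agree only in the initial call, so \<open>xs\<close> is kept general.
  The premise guarantees that \<open>xs\<close> does not run out while \<open>ys\<close> is consumed
  two elements at a time.\<close>

lemma eval_halve:
  "length ys div 2 \<le> length xs \<Longrightarrow>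
   \<exists>t\<le>20 * length ys + 10. eval prog [enc_points xs, enc_points ys] (prog ! 6)
     (Node (enc_points (take (length ys div 2) xs)) (enc_points (drop (length ys div 2) xs))) t"
proof (induction ys arbitrary: xs rule: induct_list012)
  case 1
  show ?case
    by (rule run_bounded, subst prog_nth, unfold halve_body_def) (simp add: enc_points_def)
next
  case (2 y)
  show ?case
    by (rule run_bounded, subst prog_nth, unfold halve_body_def) (simp add: enc_points_def)
next
  case (3 y y' ys)
  then obtain x xs' where xs: "xs = x # xs'" by (cases xs) auto
  with 3 obtain t where t: "t \<le> 20 * length ys + 10"
    "eval prog [enc_points xs', enc_points ys] (prog ! 6)
     (Node (enc_points (take (length ys div 2) xs')) (enc_points (drop (length ys div 2) xs'))) t"
    by (auto)
  show ?case
    by (rule run_bounded, subst prog_nth, unfold halve_body_def)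
      (use t(1) in \<open>simp add: xs enc_points_def run_eval[OF t(2)[unfolded enc_points_def]]\<close>)
qed

lemma eval_emit:
  "\<exists>t\<le>20 * length zs + 10. eval prog [Coord h, enc_points zs, enc_points acc] (prog ! 7)
     (enc_points (map (\<lambda>z. (fst z, h)) zs @ acc)) t"
proof (induction zs)
  case Nil
  show ?case
    by (rule run_bounded, subst prog_nth, unfold emit_body_def) (simp add: enc_points_def)
next
  case (Cons z zs)
  from Cons.IH obtain t where t: "t \<le> 20 * length zs + 10"
    "eval prog [Coord h, enc_points zs, enc_points acc] (prog ! 7)
     (enc_points (map (\<lambda>z. (fst z, h)) zs @ acc)) t" by blast
  show ?case
    by (rule run_bounded, subst prog_nth, unfold emit_body_def)
      (use t(1) in \<open>simp add: enc_points_def enc_point_def run_eval[OF t(2)[unfolded enc_points_def]]\<close>)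
qed

text \<open>The mixed term \<open>400 * k * m\<close> in the expanded square pays for halving,
  emission and overhead, since \<open>k + m\<close> \<le> \<open>k * m + 1\<close> for positive
  \<open>k\<close> and \<open>m\<close>.\<close>

lemma bisect_time_step:
  fixes k m :: nat
  assumes "1 \<le> k" "1 \<le> m" and "t1 \<le> 200 * m\<^sup>2 + 10" "t2 \<le> 200 * k\<^sup>2 + 10"
    and "t3 \<le> 20 * (k + m) + 10" "t4 \<le> 20 * (k + m) + 10"
  shows "t1 + t2 + t3 + t4 + 40 \<le> 200 * (k + m)\<^sup>2 + 10"
proof -
  obtain k' where k': "k = Suc k'" using assms(1) by (cases k) simp_all
  obtain m' where m': "m = Suc m'" using assms(2) by (cases m) simp_all
  define km where "km = k * m"
  have "k + m \<le> km + 1" "1 \<le> km" by (simp_all add: km_def k' m')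
  then have "t1 + t2 + t3 + t4 + 40 \<le> 200 * (k\<^sup>2 + m\<^sup>2 + 2 * km) + 10"
    using assms(3-6) by simp
  also have "k\<^sup>2 + m\<^sup>2 + 2 * km = (k + m)\<^sup>2"
    by (simp add: km_def power2_eq_square algebra_simps)
  finally show ?thesis .
qed

lemma eval_bisect:
  "\<exists>t\<le>200 * (length zs)\<^sup>2 + 10. eval prog [enc_points zs, enc_points acc] (prog ! 8)
     (enc_points (bisect zs @ acc)) t"
proof (induction zs arbitrary: acc rule: bisect.induct)
  case (1 zs)
  consider "zs = []" | z where "zs = [z]" | x y zs' where "zs = x # y # zs'"
    by (cases zs; cases "tl zs") auto
  then show ?case
  proof cases
    case 1
    then show ?thesis
      by - (rule run_bounded, subst prog_nth, unfold bisect_body_def,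
        simp add: enc_points_def bisect.simps)
  next
    case 2
    then show ?thesis
      by - (rule run_bounded, subst prog_nth, unfold bisect_body_def,
        simp add: enc_points_def bisect.simps)
  next
    case 3
    then have len: "\<not> length zs < 2" by simp
    define k where "k = length zs div 2"
    define h where "h = snd (zs ! k)"
    define m where "m = length zs - k"
    have n: "length zs = k + m" "1 \<le> k" "1 \<le> m" using len by (auto simp: k_def m_def)
    have bis: "bisect zs = map (\<lambda>z. (fst z, h)) zs @ bisect (take k zs) @ bisect (drop k zs)"
      using len by (subst bisect.simps) (simp add: k_def h_def)
    have lens: "length (take k zs) = k" "length (drop k zs) = m" using n(1) by simp_all
    obtain t1 where t1: "t1 \<le> 200 * m\<^sup>2 + 10"
      "eval prog [enc_points (drop k zs), enc_points acc] (prog ! 8)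
         (enc_points (bisect (drop k zs) @ acc)) t1"
      using "1.IH"(2)[OF len, folded k_def, of acc, unfolded lens] by blast
    obtain t2 where t2: "t2 \<le> 200 * k\<^sup>2 + 10"
      "eval prog [enc_points (take k zs), enc_points (bisect (drop k zs) @ acc)] (prog ! 8)
         (enc_points (bisect (take k zs) @ bisect (drop k zs) @ acc)) t2"
      using "1.IH"(1)[OF len, folded k_def, of "bisect (drop k zs) @ acc", unfolded lens] by blast
    obtain t3 where t3: "t3 \<le> 20 * length zs + 10"
      "eval prog [enc_points zs, enc_points zs] (prog ! 6)
         (Node (enc_points (take k zs)) (enc_points (drop k zs))) t3"
      using eval_halve[of zs zs] by (auto simp: k_def)
    obtain t4 where t4: "t4 \<le> 20 * length zs + 10"
      "eval prog [Coord h, enc_points zs, enc_points (bisect (take k zs) @ bisect (drop k zs) @ acc)]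
         (prog ! 7) (enc_points (bisect zs @ acc)) t4"
      using eval_emit[of zs h "bisect (take k zs) @ bisect (drop k zs) @ acc"] by (auto simp: bis)
    have "drop k zs = zs ! k # drop (Suc k) zs"
      using n by (intro Cons_nth_drop_Suc[symmetric]) simp
    then have med: "val_snd (val_fst (enc_points (drop k zs))) = Coord h"
      by (simp add: enc_points_def enc_point_def h_def)
    have node: "is_node (enc_points zs)" "is_node (val_snd (enc_points zs))"
      using 3 by (simp_all add: enc_points_def)
    from bisect_time_step[OF n(2,3) t1(1) t2(1) t3(1)[unfolded n(1)] t4(1)[unfolded n(1)]]
    have "t1 + t2 + t3 + t4 + 40 \<le> 200 * (k + m)\<^sup>2 + 10" .
    then show ?thesis
      by - (rule run_bounded, subst prog_nth, unfold bisect_body_def,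
        simp add: node med run_eval[OF t1(2)] run_eval[OF t2(2)] run_eval[OF t3(2)]
          run_eval[OF t4(2)] n(1))
  qed
qed

lemma computes_prog:
  "\<exists>t\<le>2000 * (length ds + 1)\<^sup>2.
     computes prog (enc_instance ps ds) (enc_points (bisect (stabs ds))) t"
proof -
  define n where "n = length ds"
  let ?is = "sort_key (\<lambda>i. snd (snd i)) (items ds)"
  have len: "length (items ds) \<le> 2 * n" unfolding n_def by (rule length_items)
  have len': "length (stabs ds) \<le> 2 * n"
    using length_greedy[of ?is "[]"] len by (simp add: stabs_def)
  obtain t1 where t1: "t1 \<le> 60 * n + 5"
    "eval prog [enc_list enc_demand ds] (prog ! Suc 0) (enc_list enc_item (items ds)) t1"
    using eval_items unfolding n_def by blast
  obtain t2 where t2: "t2 \<le> 40 * (length (items ds) + 1)\<^sup>2"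
    "eval prog [enc_list enc_item (items ds)] (prog ! 3) (enc_list enc_item ?is) t2"
    using eval_sort by blast
  obtain t3 where t3: "t3 \<le> 50 * length ?is * (length ?is + length ([] :: point list) + 1) + 4"
    "eval prog [enc_list enc_item ?is, enc_points []] (prog ! 5) (enc_points (stabs ds)) t3"
    using eval_greedy unfolding stabs_def by blast
  obtain t4 where t4: "t4 \<le> 200 * (length (stabs ds))\<^sup>2 + 10"
    "eval prog [enc_points (stabs ds), enc_points []] (prog ! 8)
       (enc_points (bisect (stabs ds) @ [])) t4"
    using eval_bisect by blast
  have "t2 \<le> 40 * (2 * n + 1)\<^sup>2"
    using t2(1) len by (meson add_le_mono1 le_trans mult_le_mono2 power_mono zero_le)
  moreover have "t3 \<le> 50 * (2 * n) * (2 * n + 1) + 4"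
  proof -
    have "50 * length ?is * (length ?is + 1) \<le> 50 * (2 * n) * (2 * n + 1)"
      using len by (intro mult_le_mono) auto
    then show ?thesis using t3(1) by simp
  qed
  moreover have "t4 \<le> 200 * (2 * n)\<^sup>2 + 10"
    using t4(1) len' by (meson add_le_mono1 le_trans mult_le_mono2 power_mono zero_le)
  \<comment> \<open>The summand 40 covers the steps of \<open>main_body\<close> itself.\<close>
  ultimately have total: "t1 + t2 + t3 + t4 + 40 \<le> 2000 * (n + 1)\<^sup>2"
    using t1(1) by (simp add: power2_eq_square algebra_simps)
  have "\<exists>t\<le>2000 * (n + 1)\<^sup>2. eval prog [enc_instance ps ds] (ECall 0 [EVar 0])
      (enc_points (bisect (stabs ds))) t"
    by (rule run_bounded, simp, subst prog_nth(1), unfold main_body_def)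
      (use total t3(2) t4(2) in \<open>simp add: enc_instance_def enc_points_def
        run_eval[OF t1(2)] run_eval[OF t2(2)]
        run_eval[OF t3(2)[unfolded enc_points_def, simplified]]
        run_eval[OF t4(2)[unfolded enc_points_def, simplified]]\<close>)
  then show ?thesis by (simp add: computes_def n_def)
qed

theorem theorem2:
  "\<exists>(F :: program) (b :: nat poly) (C :: real).
     \<forall>(s :: nat) (P :: point set) (D :: (point \<times> point) set) ps ds.
       1 \<le> s \<longrightarrow> gmconn_instance P D \<longrightarrow> thin s P \<longrightarrow> lists_instance ps ds P D \<longrightarrow>
         (\<exists>qs t. computes F (enc_instance ps ds) (enc_points qs) t \<and>
            t \<le> poly b (card P + card D) \<and>
            feasible P D (set qs) \<and>
            real (card (set qs)) \<le> C * log 2 (real s) * real (opt P D))"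
proof -
  have "\<exists>qs t. computes prog (enc_instance ps ds) (enc_points qs) t \<and>
      t \<le> poly (smult 2000 ([:1, 1:] ^ 2)) (card P + card D) \<and> feasible P D (set qs) \<and>
      real (card (set qs)) \<le> 8 * log 2 (real s) * real (opt P D)"
    if "1 \<le> s" "gmconn_instance P D" "thin s P" "lists_instance ps ds P D" for s P D ps ds
  proof -
    have D: "D = set ds" "length ds = card D"
      using that(4) by (auto simp: lists_instance_def distinct_card)
    obtain t where t: "t \<le> 2000 * (length ds + 1)\<^sup>2"
        "computes prog (enc_instance ps ds) (enc_points (bisect (stabs ds))) t"
      using computes_prog by blast
    \<comment> \<open>The polynomial is 2000 times the square of \<open>x + 1\<close>; monotonicity
      replaces \<open>card D\<close> by \<open>card P + card D\<close>.\<close>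
    have "2000 * (length ds + 1)\<^sup>2 \<le> 2000 * (1 + (card P + card D))\<^sup>2"
      using D(2) by (intro mult_le_mono2 power_mono) auto
    also have "\<dots> = poly (smult 2000 ([:1, 1:] ^ 2)) (card P + card D)"
      by (simp add: poly_power)
    finally have "t \<le> poly (smult 2000 ([:1, 1:] ^ 2)) (card P + card D)"
      using t(1) by (rule le_trans[rotated])
    then show ?thesis
      using t(2) feasible_bisect_stabs card_bisect_stabs that(1-3) unfolding D(1) by blast
  qed
  then show ?thesis by blast
qed

end
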